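(* Let $\mathbf S=(S,\wedge,0)$ be an atomic meet-semilattice with least element $0$, and let $\operatorname{At}\mathbf S$ denote the set of all atoms of $\mathbf S$. Then the lattice $\mathbf{Cl}(\mathbf S)=(\mathrm{Cl}(\mathbf S),\subseteq)$ of closed subsets of $S$ is isomorphic to the Boolean algebra $(2^{\operatorname{At}\mathbf S},\subseteq)$ of all subsets of $\operatorname{At}\mathbf S$.
   Context: For a meet-semilattice $\mathbf S=(S,\wedge,0)$ with least element $0$, the orthogonality relation on $S$ is defined by $x\perp y$ iff $x\wedge y=0$. For $A\subseteq S$ put $A^\perp:=\{x\in S\mid x\perp y\text{ for all }y\in A\}$. A subset $A\subseteq S$ is called closed if $A^{\perp\perp}=A$; $\mathrm{Cl}(\mathbf S)$ is the set of all closed subsets of $S$, ordered by inclusion. $\mathbf S$ is atomic if every nonzero element lies above some atom (an atom being a minimal element of $S\setminus\{0\}$). *)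

theory Defs
  imports Main
begin

text \<open>A meet-semilattice with least element is a type of sort
  \<open>{semilattice_inf, order_bot}\<close>: \<open>S\<close> is \<open>UNIV\<close>, \<open>\<and>\<close> is \<open>inf\<close> and \<open>0\<close> is \<open>bot\<close>.\<close>

definition orthogonal :: "'a::{semilattice_inf, order_bot} \<Rightarrow> 'a \<Rightarrow> bool"
  where "orthogonal x y \<longleftrightarrow> inf x y = bot"

definition perp :: "'a::{semilattice_inf, order_bot} set \<Rightarrow> 'a set"
  where "perp A = {x. \<forall>y\<in>A. orthogonal x y}"

definition Cl :: "'a::{semilattice_inf, order_bot} set set"
  where "Cl = {A. perp (perp A) = A}"

definition At :: "'a::{semilattice_inf, order_bot} set"
  where "At = {a. a \<noteq> bot \<and> (\<forall>x. x \<noteq> bot \<and> x \<le> a \<longrightarrow> x = a)}"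

definition order_isomorphism_betw :: "('a::order \<Rightarrow> 'b::order) \<Rightarrow> 'a set \<Rightarrow> 'b set \<Rightarrow> bool"
  where "order_isomorphism_betw f X Y \<longleftrightarrow>
    bij_betw f X Y \<and> (\<forall>x\<in>X. \<forall>y\<in>X. x \<le> y \<longleftrightarrow> f x \<le> f y)"

end

theory Submission
  imports Defs
begin

text \<open>The isomorphism is \<open>A \<mapsto> A \<inter> At\<close>, with inverse \<open>B \<mapsto> perp (At - B)\<close>. An atom is orthogonal
  to exactly those elements that it does not lie below; thus distinct atoms are orthogonal, and
  \<open>perp (At - B)\<close> consists of the elements whose atoms all lie in \<open>B\<close>. Atomicity is what makes a
  closed set determined by its atoms: if \<open>x\<close> is not in \<open>perp C\<close>, then \<open>inf x y \<noteq> bot\<close> for some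
  \<open>y \<in> C\<close>, and an atom below \<open>inf x y\<close> is an atom below \<open>x\<close> that is not in \<open>perp C\<close>.\<close>

lemma orthogonal_commute: "orthogonal x y \<longleftrightarrow> orthogonal y x"
  by (simp add: orthogonal_def inf_commute)

lemma orthogonal_antimono_left:
  assumes "x \<le> x'" and "orthogonal x' y"
  shows "orthogonal x y"
proof -
  have "inf x y \<le> inf x' y"
    using \<open>x \<le> x'\<close> by (rule inf_mono) (rule order_refl)
  also have "\<dots> = bot"
    using \<open>orthogonal x' y\<close> by (simp only: orthogonal_def)
  finally show ?thesis
    by (simp only: orthogonal_def bot_unique)
qed

lemma atom_orthogonal_iff_not_le:
  assumes "a \<in> At"
  shows "orthogonal a x \<longleftrightarrow> \<not> a \<le> x"
proof -
  have "a \<noteq> bot" and "inf a x \<noteq> bot \<Longrightarrow> inf a x = a"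
    using assms by (simp_all add: At_def)
  then show ?thesis
    by (auto simp: orthogonal_def inf_absorb1 intro: inf.orderI)
qed

lemma atoms_orthogonal_iff_neq:
  assumes "a \<in> At" and "b \<in> At"
  shows "orthogonal a b \<longleftrightarrow> a \<noteq> b"
  using assms by (auto simp: atom_orthogonal_iff_not_le At_def)

lemma perp_antimono: "A \<subseteq> B \<Longrightarrow> perp B \<subseteq> perp A"
  by (auto simp: perp_def)

lemma subset_perp_perp: "A \<subseteq> perp (perp A)"
  by (auto simp: perp_def orthogonal_commute)

lemma perp_in_Cl: "perp A \<in> Cl"
proof -
  have "perp (perp (perp A)) = perp A"
    by (intro subset_antisym perp_antimono subset_perp_perp)
  then show ?thesis
    by (simp add: Cl_def)
qed

lemma perp_downward_closed: "x \<in> perp A \<Longrightarrow> y \<le> x \<Longrightarrow> y \<in> perp A"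
  by (auto simp: perp_def intro: orthogonal_antimono_left)

lemma mem_perp_atoms_iff:
  assumes "B \<subseteq> At"
  shows "x \<in> perp B \<longleftrightarrow> (\<forall>b\<in>B. \<not> b \<le> x)"
proof -
  have "orthogonal x b \<longleftrightarrow> \<not> b \<le> x" if "b \<in> B" for b
    using that assms by (auto simp: orthogonal_commute[of x] atom_orthogonal_iff_not_le)
  then show ?thesis
    by (simp add: perp_def)
qed

lemma perp_At_Diff_Int_At:
  assumes "B \<subseteq> At"
  shows "perp (At - B) \<inter> At = B"
  using assms by (auto simp: perp_def atoms_orthogonal_iff_neq)

lemma mem_perp_iff_atoms_below:
  fixes x :: "'a::{semilattice_inf, order_bot}"
  assumes atomic: "\<forall>x::'a. x \<noteq> bot \<longrightarrow> (\<exists>a\<in>At. a \<le> x)"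
  shows "x \<in> perp C \<longleftrightarrow> (\<forall>a\<in>At. a \<le> x \<longrightarrow> a \<in> perp C)"
proof
  assume "x \<in> perp C"
  then show "\<forall>a\<in>At. a \<le> x \<longrightarrow> a \<in> perp C"
    by (blast intro: perp_downward_closed)
next
  assume atoms_in_perp: "\<forall>a\<in>At. a \<le> x \<longrightarrow> a \<in> perp C"
  show "x \<in> perp C"
  proof (rule ccontr)
    assume "x \<notin> perp C"
    then obtain y where "y \<in> C" and "inf x y \<noteq> bot"
      by (auto simp: perp_def orthogonal_def)
    with atomic obtain a where "a \<in> At" and "a \<le> x" and "a \<le> y"
      by (meson le_inf_iff)
    moreover have "orthogonal a y"
      using atoms_in_perp \<open>a \<in> At\<close> \<open>a \<le> x\<close> \<open>y \<in> C\<close> by (simp add: perp_def)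
    ultimately show False
      by (simp add: atom_orthogonal_iff_not_le)
  qed
qed

lemma perp_At_Diff_Cl:
  fixes A :: "'a::{semilattice_inf, order_bot} set"
  assumes atomic: "\<forall>x::'a. x \<noteq> bot \<longrightarrow> (\<exists>a\<in>At. a \<le> x)"
    and "A \<in> Cl"
  shows "perp (At - A) = A"
proof (rule set_eqI)
  fix x
  have "x \<in> perp (At - A) \<longleftrightarrow> (\<forall>a\<in>At. a \<le> x \<longrightarrow> a \<in> A)"
    by (auto simp: mem_perp_atoms_iff)
  also have "\<dots> \<longleftrightarrow> x \<in> A"
    using mem_perp_iff_atoms_below[OF atomic, of x "perp A"] \<open>A \<in> Cl\<close> by (simp add: Cl_def)
  finally show "x \<in> perp (At - A) \<longleftrightarrow> x \<in> A" .
qed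

lemma order_isomorphism_betw_byWitness:
  assumes "mono_on X f" and "mono_on Y g"
    and image: "f ` X \<subseteq> Y" "g ` Y \<subseteq> X"
    and inverse: "\<forall>x\<in>X. g (f x) = x" "\<forall>y\<in>Y. f (g y) = y"
  shows "order_isomorphism_betw f X Y"
proof -
  have "x \<le> x'" if "x \<in> X" "x' \<in> X" "f x \<le> f x'" for x x'
    using mono_onD[OF \<open>mono_on Y g\<close>, of "f x" "f x'"] that image inverse by auto
  then show ?thesis
    using assms by (auto simp: order_isomorphism_betw_def intro: bij_betw_byWitness dest: mono_onD)
qed

theorem theorem1:
  assumes atomic: "\<forall>x::'a::{semilattice_inf, order_bot}. x \<noteq> bot \<longrightarrow> (\<exists>a\<in>At. a \<le> x)"
  shows "\<exists>f. order_isomorphism_betw f (Cl :: 'a set set) (Pow (At :: 'a set))"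
proof
  show "order_isomorphism_betw (\<lambda>A. A \<inter> At) (Cl :: 'a set set) (Pow At)"
  proof (rule order_isomorphism_betw_byWitness)
    show "mono_on Cl (\<lambda>A::'a set. A \<inter> At)"
      by (blast intro: mono_onI)
    show "mono_on (Pow At) (\<lambda>B::'a set. perp (At - B))"
      by (intro mono_onI perp_antimono Diff_mono order_refl)
    show "(\<lambda>A. A \<inter> At) ` Cl \<subseteq> Pow (At :: 'a set)"
      by blast
    show "(\<lambda>B. perp (At - B)) ` Pow At \<subseteq> (Cl :: 'a set set)"
      by (blast intro: perp_in_Cl)
    show "\<forall>A\<in>Cl. perp (At - (A \<inter> At)) = (A :: 'a set)"
      by (simp add: Diff_Int perp_At_Diff_Cl[OF atomic])
    show "\<forall>B\<in>Pow At. perp (At - B) \<inter> At = (B :: 'a set)"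
      by (simp add: perp_At_Diff_Int_At)
  qed
qed

end
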